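(* Let $G \leq \mathfrak{S}_n$ be a permutation group. Suppose that for any multiaffine $G$-invariant polynomial $f \in \mathbb{C}[z_1,\ldots,z_n]$ and any $\zeta_1,\ldots,\zeta_n \in \mathcal{H}$ there is a $\zeta \in \mathcal{H}$ such that $$f(\zeta_1,\ldots,\zeta_n)=f(\zeta,\ldots,\zeta).$$ Then every $G$-invariant polynomial is also $\mathfrak{S}_n$-invariant (i.e., symmetric).
   Context: $\mathcal{H}=\{z\in\mathbb{C} : \operatorname{Im} z>0\}$ is the open upper half-plane. $\mathfrak{S}_n$ is the symmetric group on $\{1,\ldots,n\}$. It acts on $\mathbb{C}[z_1,\ldots,z_n]$ by $\mathbb{C}$-algebra automorphisms with $\sigma(z_i)=z_{\sigma(i)}$ for $\sigma\in\mathfrak{S}_n$; any subgroup acts by restriction. For a subgroup $G\leq\mathfrak{S}_n$, a polynomial $f\in\mathbb{C}[z_1,\ldots,z_n]$ is $G$-invariant if $\sigma(f)=f$ for all $\sigma\in G$. A polynomial is multiaffine if each variable occurs in it at most to the first power.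
   Formalization: The conclusion is proved for multiaffine G-invariant polynomials only; for arbitrary G-invariant polynomials it is false (G the alternating group A_3 with the Vandermonde polynomial). *)

theory Defs
  imports Complex_Main "HOL-Library.Poly_Mapping" "HOL-Algebra.Sym_Groups"
begin

text \<open>
  Polynomials are finitely supported maps from monomials to coefficients, and a monomial is a
  finitely supported exponent vector; the ring structure (convolution product) is the one of
  \<^theory>\<open>HOL-Library.Poly_Mapping\<close>.  The variables are indexed by all natural numbers, and
  \<open>polys n\<close> is the subring of polynomials in the variables with indices \<open>1, \<dots>, n\<close>.
\<close>

type_synonym cpoly = "(nat \<Rightarrow>\<^sub>0 nat) \<Rightarrow>\<^sub>0 complex"

definition var :: "nat \<Rightarrow> cpoly"
  where "var i = Poly_Mapping.single (Poly_Mapping.single i 1) 1"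

definition const :: "complex \<Rightarrow> cpoly"
  where "const c = Poly_Mapping.single 0 c"

definition polys :: "nat \<Rightarrow> cpoly set"
  where "polys n = {f. \<forall>m \<in> Poly_Mapping.keys f. Poly_Mapping.keys m \<subseteq> {1..n}}"

text \<open>
  \<open>subst_poly c h\<close> is the ring homomorphism on polynomials that sends the \<open>i\<close>-th variable to
  \<open>h i\<close> and maps coefficients along the ring homomorphism \<open>c\<close>.
\<close>

definition subst_poly :: "(complex \<Rightarrow> 'a) \<Rightarrow> (nat \<Rightarrow> 'a) \<Rightarrow> cpoly \<Rightarrow> 'a::comm_ring_1"
  where "subst_poly c h f =
    (\<Sum>m \<in> Poly_Mapping.keys f. c (Poly_Mapping.lookup f m) *
       (\<Prod>i \<in> Poly_Mapping.keys m. h i ^ Poly_Mapping.lookup m i))"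

definition eval_poly :: "cpoly \<Rightarrow> (nat \<Rightarrow> complex) \<Rightarrow> complex"
  where "eval_poly f \<zeta> = subst_poly (\<lambda>c. c) \<zeta> f"

definition perm_act :: "(nat \<Rightarrow> nat) \<Rightarrow> cpoly \<Rightarrow> cpoly"
  where "perm_act \<sigma> f = subst_poly const (\<lambda>i. var (\<sigma> i)) f"

definition invariant_under :: "(nat \<Rightarrow> nat) set \<Rightarrow> cpoly \<Rightarrow> bool"
  where "invariant_under G f \<longleftrightarrow> (\<forall>\<sigma> \<in> G. perm_act \<sigma> f = f)"

definition multiaffine :: "cpoly \<Rightarrow> bool"
  where "multiaffine f \<longleftrightarrow> (\<forall>m \<in> Poly_Mapping.keys f. \<forall>i. Poly_Mapping.lookup m i \<le> 1)"

definition upper_half_plane :: "complex set"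
  where "upper_half_plane = {z. Im z > 0}"

text \<open>
  In the converse to the Grace-Walsh-Szegoe coincidence theorem, the conclusion that every
  \<open>G\<close>-invariant polynomial is symmetric has to be read for multiaffine polynomials, like the
  hypothesis.  For arbitrary polynomials it fails: for \<open>n \<ge> 3\<close> the alternating group has only
  symmetric multiaffine invariants, so it satisfies the hypothesis by the
  Grace-Walsh-Szegoe theorem, but the Vandermonde polynomial is invariant under it and is not
  symmetric.
\<close>

end

theory Submission
  imports Defs "HOL-Library.Nat_Bijection" "HOL-Computational_Algebra.Polynomial"
begin

text \<open>
  If \<open>f\<close> is a multiaffine \<open>G\<close>-invariant, then so is \<open>g = \<Sum>\<sigma>. (\<sigma> f - f)\<close>, the sum ranging over
  the whole symmetric group.  All \<open>\<sigma> f\<close> agree on the diagonal, so \<open>g\<close> vanishes there, and by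
  hypothesis it vanishes at every point with coordinates in the upper half-plane.  Hence
  \<open>g = 0\<close>, that is, \<open>f\<close> is its own symmetrization.
\<close>

section \<open>Permutation of variables as reindexing of coefficients\<close>

abbreviation permute_poly :: "(nat \<Rightarrow> nat) \<Rightarrow> cpoly \<Rightarrow> cpoly"
  where "permute_poly \<sigma> \<equiv> Poly_Mapping.map_key (Poly_Mapping.map_key \<sigma>)"

lemma lookup_map_key_bij:
  "bij \<sigma> \<Longrightarrow> Poly_Mapping.lookup (Poly_Mapping.map_key \<sigma> m) = Poly_Mapping.lookup m \<circ> \<sigma>"
  by (simp add: map_key.rep_eq bij_is_inj)

text \<open>Needed for the outer \<open>map_key\<close> of \<open>permute_poly\<close>, whose
  coefficient formula requires the reindexing map on monomials to be injective.\<close>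

lemma inj_map_key_bij:
  fixes \<sigma> :: "'a \<Rightarrow> 'a"
  assumes "bij \<sigma>"
  shows "inj (Poly_Mapping.map_key \<sigma> :: ('a \<Rightarrow>\<^sub>0 'b::zero) \<Rightarrow> _)"
proof (rule injI, rule poly_mapping_eqI)
  fix m m' :: "'a \<Rightarrow>\<^sub>0 'b" and i
  assume "Poly_Mapping.map_key \<sigma> m = Poly_Mapping.map_key \<sigma> m'"
  then have "Poly_Mapping.lookup m \<circ> \<sigma> = Poly_Mapping.lookup m' \<circ> \<sigma>"
    using lookup_map_key_bij[OF assms] by metis
  then have "Poly_Mapping.lookup m (\<sigma> (inv' \<sigma> i)) = Poly_Mapping.lookup m' (\<sigma> (inv' \<sigma> i))"
    by (metis comp_apply)
  then show "Poly_Mapping.lookup m i = Poly_Mapping.lookup m' i"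
    using assms by (simp add: bij_is_surj surj_f_inv_f)
qed

text \<open>Replacing each variable i by variable \<sigma> i turns the monomial with exponents m
  \<circ> \<sigma> into the one with exponents m, so this is the coefficient expected of the
  permuted polynomial.\<close>

lemma lookup_permute_poly:
  assumes "bij \<sigma>"
  shows "Poly_Mapping.lookup (permute_poly \<sigma> f) m =
    Poly_Mapping.lookup f (Poly_Mapping.map_key \<sigma> m)"
  by (simp add: map_key.rep_eq[OF inj_map_key_bij[OF assms]])

lemma map_key_inv_bij:
  assumes "bij \<sigma>"
  shows "Poly_Mapping.map_key \<sigma> (Poly_Mapping.map_key (inv' \<sigma>) m) = m"
  using assms
  by (intro poly_mapping_eqI)
    (simp add: lookup_map_key_bij bij_imp_bij_inv bij_is_inj)

lemma var_power: "var i ^ k = Poly_Mapping.single (Poly_Mapping.single i k) 1"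
  by (induction k) (simp_all add: var_def mult_single flip: single_add)

lemma prod_single_one:
  "finite A \<Longrightarrow> (\<Prod>i\<in>A. Poly_Mapping.single (g i) (1::'b::comm_semiring_1)) =
    Poly_Mapping.single (\<Sum>i\<in>A. g i :: 'a::comm_monoid_add) 1"
  by (induction A rule: finite_induct) (simp_all add: mult_single)

text \<open>This is the exponent vector of a monomial after the substitution. The exponent at j
  comes from the only i with \<sigma> i = j, hence the inverse.\<close>

lemma sum_single_permuted:
  assumes "bij \<sigma>"
  shows "(\<Sum>i\<in>Poly_Mapping.keys m. Poly_Mapping.single (\<sigma> i) (Poly_Mapping.lookup m i)) =
    Poly_Mapping.map_key (inv' \<sigma>) m"
proof (rule poly_mapping_eqI)
  fix j
  have eq: "\<sigma> i = j \<longleftrightarrow> i = inv' \<sigma> j" for i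
    using assms by (metis bij_inv_eq_iff)
  show "Poly_Mapping.lookup
      (\<Sum>i\<in>Poly_Mapping.keys m. Poly_Mapping.single (\<sigma> i) (Poly_Mapping.lookup m i)) j =
    Poly_Mapping.lookup (Poly_Mapping.map_key (inv' \<sigma>) m) j"
    using assms
    by (simp add: lookup_sum lookup_single when_def eq lookup_map_key_bij bij_imp_bij_inv
        in_keys_iff)
qed

lemma perm_act_eq_permute_poly:
  assumes "bij \<sigma>"
  shows "perm_act \<sigma> f = permute_poly \<sigma> f"
proof (rule poly_mapping_eqI)
  fix m
  \<comment> \<open>Exactly one term of the substituted sum lands on the monomial m, namely the one
    from \<open>Poly_Mapping.map_key \<sigma> m\<close>.\<close>
  have eq: "Poly_Mapping.map_key (inv' \<sigma>) k = m \<longleftrightarrow> k = Poly_Mapping.map_key \<sigma> m"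
    for k :: "nat \<Rightarrow>\<^sub>0 nat"
    using map_key_inv_bij[OF assms] map_key_inv_bij[OF bij_imp_bij_inv[OF assms]] assms
    by (metis inv_inv_eq)
  have "perm_act \<sigma> f = (\<Sum>k\<in>Poly_Mapping.keys f.
      Poly_Mapping.single (Poly_Mapping.map_key (inv' \<sigma>) k) (Poly_Mapping.lookup f k))"
    using assms
    by (simp add: perm_act_def subst_poly_def const_def var_power prod_single_one
        sum_single_permuted mult_single)
  then show "Poly_Mapping.lookup (perm_act \<sigma> f) m =
      Poly_Mapping.lookup (permute_poly \<sigma> f) m"
    using assms
    by (simp add: lookup_permute_poly lookup_sum lookup_single when_def eq in_keys_iff)
qed

text \<open>Pullback reverses composition once on monomials and once more on polynomials, so the
  result is a left action.\<close>

lemma permute_poly_comp: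
  assumes "bij \<sigma>" "bij \<tau>"
  shows "permute_poly \<tau> (permute_poly \<sigma> f) = permute_poly (\<tau> \<circ> \<sigma>) f"
  using assms
  by (intro poly_mapping_eqI) (simp add: lookup_permute_poly map_key_compose bij_is_inj bij_comp)

lemma permute_poly_diff:
  "bij \<sigma> \<Longrightarrow> permute_poly \<sigma> (f - g) = permute_poly \<sigma> f - permute_poly \<sigma> g"
  by (intro poly_mapping_eqI) (simp add: lookup_permute_poly lookup_minus)

lemma permute_poly_sum:
  "bij \<sigma> \<Longrightarrow> permute_poly \<sigma> (\<Sum>x\<in>A. f x) = (\<Sum>x\<in>A. permute_poly \<sigma> (f x))"
  by (intro poly_mapping_eqI) (simp add: lookup_permute_poly lookup_sum)

section \<open>Evaluation and its behaviour on the diagonal\<close>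

lemma eval_poly_superset:
  assumes "finite K" "Poly_Mapping.keys f \<subseteq> K"
  shows "eval_poly f \<zeta> = (\<Sum>m\<in>K. Poly_Mapping.lookup f m *
    (\<Prod>i\<in>Poly_Mapping.keys m. \<zeta> i ^ Poly_Mapping.lookup m i))"
  unfolding eval_poly_def subst_poly_def
  by (rule sum.mono_neutral_left[OF assms]) (simp add: in_keys_iff)

lemma eval_poly_diff: "eval_poly (f - g) \<zeta> = eval_poly f \<zeta> - eval_poly g \<zeta>"
proof -
  \<comment> \<open>The supports of the three polynomials may differ; padding with zero coefficients
    puts all three sums over one index set.\<close>
  let ?K = "Poly_Mapping.keys f \<union> Poly_Mapping.keys g"
  have "Poly_Mapping.keys (f - g) \<subseteq> ?K"
    by (auto simp: in_keys_iff lookup_minus)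
  then show ?thesis
    by (simp add: eval_poly_superset[of ?K] lookup_minus algebra_simps sum_subtractf)
qed

lemma eval_poly_sum:
  "finite A \<Longrightarrow> eval_poly (\<Sum>x\<in>A. f x) \<zeta> = (\<Sum>x\<in>A. eval_poly (f x) \<zeta>)"
proof (induction A rule: finite_induct)
  case empty
  show ?case by (simp add: eval_poly_def subst_poly_def)
next
  case (insert x A)
  \<comment> \<open>Additivity is read off from the rule for differences: the smaller sum is the
    larger one minus the new term.\<close>
  have "eval_poly (\<Sum>y\<in>A. f y) \<zeta> = eval_poly (\<Sum>y\<in>insert x A. f y) \<zeta> - eval_poly (f x) \<zeta>"
    using insert.hyps by (simp flip: eval_poly_diff)
  then show ?case
    using insert by simp
qed

text \<open>At a diagonal point the value of a monomial depends only on its exponents as a multiset,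
  which reindexing preserves. The terms of the two sums are matched by m \<mapsto>
  \<open>Poly_Mapping.map_key \<sigma> m\<close>.\<close>

lemma eval_permute_poly_diagonal:
  assumes "bij \<sigma>"
  shows "eval_poly (permute_poly \<sigma> f) (\<lambda>_. z) = eval_poly f (\<lambda>_. z)"
  unfolding eval_poly_def subst_poly_def
proof (rule sum.reindex_bij_witness[of _ "Poly_Mapping.map_key (inv' \<sigma>)" "Poly_Mapping.map_key \<sigma>"])
  note inverses = map_key_inv_bij[OF assms]
    map_key_inv_bij[OF bij_imp_bij_inv[OF assms], unfolded inv_inv_eq[OF assms]]
  fix m :: "nat \<Rightarrow>\<^sub>0 nat"
  show "Poly_Mapping.map_key (inv' \<sigma>) (Poly_Mapping.map_key \<sigma> m) = m"
    "Poly_Mapping.map_key \<sigma> (Poly_Mapping.map_key (inv' \<sigma>) m) = m"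
    by (rule inverses)+
  show "Poly_Mapping.map_key \<sigma> m \<in> Poly_Mapping.keys f"
    if "m \<in> Poly_Mapping.keys (permute_poly \<sigma> f)"
    using that by (simp add: in_keys_iff lookup_permute_poly[OF assms])
  show "Poly_Mapping.map_key (inv' \<sigma>) m \<in> Poly_Mapping.keys (permute_poly \<sigma> f)"
    if "m \<in> Poly_Mapping.keys f"
    using that by (simp add: in_keys_iff lookup_permute_poly[OF assms] inverses)
  have "(\<Prod>i\<in>Poly_Mapping.keys (Poly_Mapping.map_key \<sigma> m).
        z ^ Poly_Mapping.lookup (Poly_Mapping.map_key \<sigma> m) i) =
      (\<Prod>i\<in>Poly_Mapping.keys m. z ^ Poly_Mapping.lookup m i)"
    using assms
    by (intro prod.reindex_bij_witness[of _ "inv' \<sigma>" \<sigma>])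
      (auto simp: keys_map_key lookup_map_key_bij bij_is_inj bij_is_surj surj_f_inv_f)
  then show "Poly_Mapping.lookup f (Poly_Mapping.map_key \<sigma> m) *
        (\<Prod>i\<in>Poly_Mapping.keys (Poly_Mapping.map_key \<sigma> m).
          z ^ Poly_Mapping.lookup (Poly_Mapping.map_key \<sigma> m) i) =
      Poly_Mapping.lookup (permute_poly \<sigma> f) m *
        (\<Prod>i\<in>Poly_Mapping.keys m. z ^ Poly_Mapping.lookup m i)"
    by (simp add: lookup_permute_poly[OF assms])
qed

section \<open>Conditions on the support, and vanishing of multiaffine polynomials\<close>

lemma polys_permute_poly:
  assumes "f \<in> polys n" "\<sigma> permutes {1..n}"
  shows "permute_poly \<sigma> f \<in> polys n"
  unfolding polys_def
proof (intro CollectI ballI subsetI)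
  note bij = permutes_bij[OF assms(2)]
  fix m i
  assume m: "m \<in> Poly_Mapping.keys (permute_poly \<sigma> f)" and i: "i \<in> Poly_Mapping.keys m"
  from m have "Poly_Mapping.map_key \<sigma> m \<in> Poly_Mapping.keys f"
    by (simp add: in_keys_iff lookup_permute_poly[OF bij])
  moreover have "inv' \<sigma> i \<in> Poly_Mapping.keys (Poly_Mapping.map_key \<sigma> m)"
    using i bij by (simp add: keys_map_key bij_is_inj bij_is_surj surj_f_inv_f)
  ultimately have "inv' \<sigma> i \<in> {1..n}"
    using assms(1) unfolding polys_def by blast
  then have "\<sigma> (inv' \<sigma> i) \<in> {1..n}"
    using assms(2) by (metis permutes_in_image)
  then show "i \<in> {1..n}"
    using bij by (simp add: bij_is_surj surj_f_inv_f)
qed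

lemma multiaffine_permute_poly:
  assumes "multiaffine f" "bij \<sigma>"
  shows "multiaffine (permute_poly \<sigma> f)"
  unfolding multiaffine_def
proof (intro ballI allI)
  fix m i
  assume "m \<in> Poly_Mapping.keys (permute_poly \<sigma> f)"
  then have "Poly_Mapping.map_key \<sigma> m \<in> Poly_Mapping.keys f"
    by (simp add: in_keys_iff lookup_permute_poly[OF assms(2)])
  then have "Poly_Mapping.lookup (Poly_Mapping.map_key \<sigma> m) (inv' \<sigma> i) \<le> 1"
    using assms(1) unfolding multiaffine_def by blast
  then show "Poly_Mapping.lookup m i \<le> 1"
    using assms(2) by (simp add: lookup_map_key_bij bij_is_surj surj_f_inv_f)
qed

text \<open>Lets conditions on single monomials (which variables occur, exponents at most 1) pass
  from a polynomial and its permuted copies to the sum of their differences.\<close>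

lemma keys_sum_diff_subset:
  "Poly_Mapping.keys (\<Sum>x\<in>A. f x - g) \<subseteq>
    (\<Union>x\<in>A. Poly_Mapping.keys (f x)) \<union> Poly_Mapping.keys (g :: 'a \<Rightarrow>\<^sub>0 'b::ab_group_add)"
proof
  fix m
  assume "m \<in> Poly_Mapping.keys (\<Sum>x\<in>A. f x - g)"
  then have "(\<Sum>x\<in>A. Poly_Mapping.lookup (f x) m - Poly_Mapping.lookup g m) \<noteq> 0"
    by (simp add: in_keys_iff lookup_sum lookup_minus)
  then obtain x where "x \<in> A" "Poly_Mapping.lookup (f x) m - Poly_Mapping.lookup g m \<noteq> 0"
    by (meson sum.neutral)
  then show "m \<in> (\<Union>x\<in>A. Poly_Mapping.keys (f x)) \<union> Poly_Mapping.keys g"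
    by (auto simp: in_keys_iff)
qed

text \<open>
  On the curve \<open>z\<^sub>j = \<i> r^(2^j)\<close>, with \<open>r > 0\<close>, distinct multiaffine monomials become multiples of
  distinct powers of \<open>r\<close>.
\<close>

lemma multiaffine_eq_0:
  assumes "multiaffine f"
    and vanish: "\<And>\<zeta>. (\<And>i. \<zeta> i \<in> upper_half_plane) \<Longrightarrow> eval_poly f \<zeta> = 0"
  shows "f = 0"
proof (rule ccontr)
  assume "f \<noteq> 0"
  then obtain m0 where m0: "m0 \<in> Poly_Mapping.keys f"
    by (metis keys_eq_empty ex_in_conv)
  \<comment> \<open>The code of a monomial with variable set A is the sum of 2^i over A: the power
    of r that a multiaffine monomial contributes on the curve. Uniqueness of binary expansions
    separates these powers.\<close>
  let ?code = "\<lambda>m :: nat \<Rightarrow>\<^sub>0 nat. set_encode (Poly_Mapping.keys m)"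
  let ?c = "\<lambda>m. Poly_Mapping.lookup f m * \<i> ^ card (Poly_Mapping.keys m)"
  \<comment> \<open>P is f restricted to the curve, as a polynomial in r; the factors in
    \<open>?c\<close> collect the imaginary units of the coordinates.\<close>
  define P where "P = (\<Sum>m\<in>Poly_Mapping.keys f. monom (?c m) (?code m))"
  have exponent: "Poly_Mapping.lookup m i = 1"
    if "m \<in> Poly_Mapping.keys f" "i \<in> Poly_Mapping.keys m" for m i
  proof -
    have "Poly_Mapping.lookup m i \<le> 1" "Poly_Mapping.lookup m i \<noteq> 0"
      using that assms(1) unfolding multiaffine_def by (auto simp: in_keys_iff)
    then show ?thesis by linarith
  qed
  have "poly P (of_real r) = 0" if "r > 0" for r :: real
  proof -
    have "(\<Prod>i\<in>Poly_Mapping.keys m. (\<i> * of_real r ^ (2 ^ i)) ^ Poly_Mapping.lookup m i) =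
        \<i> ^ card (Poly_Mapping.keys m) * of_real r ^ ?code m"
      if "m \<in> Poly_Mapping.keys f" for m
      using exponent[OF that]
      by (simp add: prod.distrib set_encode_def power_sum)
    then have "poly P (of_real r) = eval_poly f (\<lambda>i. \<i> * of_real r ^ (2 ^ i))"
      by (simp add: P_def poly_sum poly_monom eval_poly_def subst_poly_def mult.assoc)
    also have "\<dots> = 0"
      using that by (intro vanish) (simp add: upper_half_plane_def flip: of_real_power)
    finally show ?thesis .
  qed
  then have "complex_of_real ` {0<..} \<subseteq> {x. poly P x = 0}"
    by auto
  moreover have "infinite (complex_of_real ` {0<..})"
    by (simp add: finite_image_iff inj_on_def infinite_Ioi)
  ultimately have "P = 0"
    using poly_roots_finite finite_subset by blast
  \<comment> \<open>Equal codes give equal variable sets, and since all nonzero exponents are 1 the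
    monomials coincide. So no two terms of P can cancel.\<close>
  have code_eq: "?code m = ?code m0 \<longleftrightarrow> m = m0" if "m \<in> Poly_Mapping.keys f" for m
  proof
    assume "?code m = ?code m0"
    then have keys: "Poly_Mapping.keys m = Poly_Mapping.keys m0"
      by (simp add: set_encode_eq)
    show "m = m0"
    proof (rule poly_mapping_eqI)
      fix i
      show "Poly_Mapping.lookup m i = Poly_Mapping.lookup m0 i"
        using exponent that m0 keys by (metis in_keys_iff)
    qed
  qed simp
  have "0 = coeff P (?code m0)"
    by (simp add: \<open>P = 0\<close>)
  also have "\<dots> = (\<Sum>m\<in>Poly_Mapping.keys f. if m = m0 then ?c m else 0)"
    unfolding P_def coeff_sum by (rule sum.cong) (simp_all add: code_eq)
  also have "\<dots> = ?c m0"
    using m0 by simp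
  finally show False
    using m0 by (simp add: in_keys_iff)
qed

section \<open>Averaging over the full symmetric group\<close>

theorem theorem2:
  fixes n :: nat and G :: "(nat \<Rightarrow> nat) set"
  assumes "subgroup G (sym_group n)"
    and "\<And>(f :: cpoly) (\<zeta> :: nat \<Rightarrow> complex).
           f \<in> polys n \<Longrightarrow> multiaffine f \<Longrightarrow> invariant_under G f \<Longrightarrow>
           (\<forall>i \<in> {1..n}. \<zeta> i \<in> upper_half_plane) \<Longrightarrow>
           \<exists>\<xi> \<in> upper_half_plane. eval_poly f \<zeta> = eval_poly f (\<lambda>_. \<xi>)"
  shows "\<forall>f \<in> polys n. multiaffine f \<longrightarrow> invariant_under G f \<longrightarrow>
           invariant_under (carrier (sym_group n)) f"
proof (intro ballI impI)
  fix f
  assume f: "f \<in> polys n" "multiaffine f" "invariant_under G f"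
  define S where "S = {\<sigma>. \<sigma> permutes {1..n}}"
  have carrier: "carrier (sym_group n) = S"
    by (simp add: sym_group_def S_def)
  have bij: "bij \<sigma>" if "\<sigma> \<in> S" for \<sigma>
    using that unfolding S_def by (auto intro: permutes_bij)
  have [simp]: "finite S"
    unfolding S_def by (simp add: finite_permutations)
  have GS: "G \<subseteq> S"
    using subgroup.subset[OF assms(1)] carrier by simp
  define g where "g = (\<Sum>\<sigma>\<in>S. permute_poly \<sigma> f - f)"
  have translate: "(\<Sum>\<sigma>\<in>S. h (\<tau> \<circ> \<sigma>)) = (\<Sum>\<sigma>\<in>S. h \<sigma>)"
    if "\<tau> \<in> S" for \<tau> and h :: "_ \<Rightarrow> cpoly"
    using that unfolding S_def
    by (intro sum.reindex_bij_witness[of _ "\<lambda>\<sigma>. inv' \<tau> \<circ> \<sigma>" "\<lambda>\<sigma>. \<tau> \<circ> \<sigma>"])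
      (auto simp: permutes_compose permutes_inv permutes_inv_o o_assoc)
  \<comment> \<open>Reindexing by \<sigma> \<mapsto> \<tau> \<circ> \<sigma> absorbs \<tau> in the
    first term of each difference but not in the second. For \<tau> in G, where \<tau> fixes f, this
    gives invariance of g; for general \<tau> it later compares f with its permuted copy.\<close>
  have shift: "permute_poly \<tau> g = (\<Sum>\<sigma>\<in>S. permute_poly \<sigma> f - permute_poly \<tau> f)"
    if "\<tau> \<in> S" for \<tau>
    using that translate[OF that, of "\<lambda>\<sigma>. permute_poly \<sigma> f - permute_poly \<tau> f"]
    by (simp add: g_def permute_poly_sum permute_poly_diff permute_poly_comp bij)
  have g_invariant: "invariant_under G g"
    unfolding invariant_under_def
  proof
    fix \<tau> assume \<tau>: "\<tau> \<in> G"
    with GS have "\<tau> \<in> S" by auto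
    moreover have "permute_poly \<tau> f = f"
      using f(3) \<tau> perm_act_eq_permute_poly[OF bij[OF \<open>\<tau> \<in> S\<close>], of f]
      unfolding invariant_under_def by metis
    ultimately show "perm_act \<tau> g = g"
      by (simp add: perm_act_eq_permute_poly bij shift) (simp add: g_def)
  qed
  have keys_g: "m \<in> Poly_Mapping.keys f \<or>
      (\<exists>\<sigma>\<in>S. m \<in> Poly_Mapping.keys (permute_poly \<sigma> f))"
    if "m \<in> Poly_Mapping.keys g" for m
    using that keys_sum_diff_subset[of "\<lambda>\<sigma>. permute_poly \<sigma> f" f S] unfolding g_def by blast
  have g_polys: "g \<in> polys n"
  proof -
    have "permute_poly \<sigma> f \<in> polys n" if "\<sigma> \<in> S" for \<sigma>
      using that f(1) by (simp add: S_def polys_permute_poly)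
    then show ?thesis
      using keys_g f(1) unfolding polys_def by blast
  qed
  have g_multiaffine: "multiaffine g"
    using keys_g f(2) multiaffine_permute_poly[OF f(2) bij]
    unfolding multiaffine_def by meson
  have "eval_poly g (\<lambda>_. \<xi>) = 0" for \<xi>
    by (simp add: g_def eval_poly_sum eval_poly_diff eval_permute_poly_diagonal bij)
  then have "g = 0"
    using assms(2)[OF g_polys g_multiaffine g_invariant] g_multiaffine
    by (intro multiaffine_eq_0) auto
  show "invariant_under (carrier (sym_group n)) f"
    unfolding invariant_under_def carrier
  proof
    fix \<tau> assume \<tau>: "\<tau> \<in> S"
    have "permute_poly \<tau> g = g"
      using bij[OF \<tau>] by (intro poly_mapping_eqI) (simp add: \<open>g = 0\<close> lookup_permute_poly)
    \<comment> \<open>The sums of the permuted copies of f cancel, leaving \<open>card S\<close>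
      times f equal to \<open>card S\<close> times its image under \<tau>. The factor is nonzero
      because \<tau> lies in the finite set S.\<close>
    then have "f = permute_poly \<tau> f"
      using shift[OF \<tau>] \<tau> by (auto simp: g_def sum_subtractf)
    then show "perm_act \<tau> f = f"
      using \<tau> by (metis perm_act_eq_permute_poly bij)
  qed
qed

end
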